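(* Let $p>3$ be a prime and $x\in\mathbb{Z}$. For nonnegative integers $n$ let $A_n(x)=\sum_{k=0}^{n}\binom{n}{k}^2\binom{n+k}{k}^2x^k$. Then $$\sum_{k=0}^{p-1}A_k(x)\equiv\sum_{k=0}^{p-1}\frac{(2k)!^4\,p}{(4k+1)!\,k!^4}x^k\equiv\sum_{k=0}^{(p-1)/2}\binom{p+2k}{4k+1}\binom{2k}{k}^2x^k\pmod{p^2}.$$
   Context: The middle sum has rational terms whose denominators are prime to $p$ (for $p>3$), and congruence modulo $p^2$ is understood in the ring of $p$-integral rationals. *)

theory Defs
  imports Complex_Main "HOL-Computational_Algebra.Primes"
begin

definition A :: "nat \<Rightarrow> int \<Rightarrow> int" where
  "A n x = (\<Sum>k=0..n. int (n choose k) ^ 2 * int ((n + k) choose k) ^ 2 * x ^ k)"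

(* quotient_of yields the fraction in lowest terms with positive denominator,
   so this is the localization of the integers at the prime p. *)
definition p_integral :: "nat \<Rightarrow> rat set" where
  "p_integral p = {q. coprime (snd (quotient_of q)) (int p)}"

(* The library's cong is unsuitable here: in the field rat every nonzero modulus is a unit.
   Both sides are required to belong to the ring p_integral p. *)
definition p_cong :: "nat \<Rightarrow> rat \<Rightarrow> rat \<Rightarrow> rat \<Rightarrow> bool" where
  "p_cong p m a b \<longleftrightarrow>
     a \<in> p_integral p \<and> b \<in> p_integral p \<and> (\<exists>c\<in>p_integral p. a - b = m * c)"

end

theory Submission
  imports Defs
begin

text \<open>
  Write \<open>C(n,k)\<close> for the binomial coefficient. As \<open>C(n,k) C(n+k,k) = C(n+k,2k) C(2k,k)\<close>, the coefficient
  of \<open>x^k\<close> in the first sum is \<open>C(2k,k)^2\<close> times the sum of \<open>C(n+k,2k)^2\<close> over \<open>n < p\<close>. For \<open>k > (p-1)/2\<close>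
  the factor \<open>C(2k,k)^2\<close> is divisible by \<open>p^2\<close>. Otherwise expand one factor \<open>C(n+k,2k)\<close> in the
  polynomials \<open>C(n,a)\<close> and the other one in their reflections \<open>C(n+b,b)\<close> under \<open>n \<mapsto> -1-n\<close>, because
  \<open>\<Sum>n<p. C(n,a) C(n+b,b) = (-1)^a p/(a+b+1) \<Prod>i\<le>a. (1 - p/i) \<Prod>i\<le>b. (1 + p/i)\<close>.
  The terms with \<open>a+b+1 = p\<close> are not divisible by \<open>p\<close>, but after symmetrizing in \<open>a\<close> and \<open>b\<close> the linear
  terms of the two products cancel, so that modulo \<open>p^2\<close> the products may be replaced by \<open>1\<close>.
  What remains is \<open>p\<close> times the integral of \<open>t^(2k) (1-t)^(2k)\<close> over \<open>[0,1]\<close>,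
  that is \<open>p (2k)!^2/(4k+1)!\<close>. The same product formula with \<open>a = b = 2k\<close> evaluates \<open>C(p+2k,4k+1)\<close>.
\<close>

section \<open>Sums against binomial coefficients\<close>

text \<open>Pascal's rule in operator form: with E the shift of \<open>f\<close>, the sum is (1+E)^m
  f evaluated at 0, and one factor 1+E is absorbed into \<open>f\<close>. It drives all the
  inductions of this section.\<close>

lemma sum_choose_Suc:
  fixes f :: "nat \<Rightarrow> 'a::comm_semiring_1"
  shows "(\<Sum>i\<le>Suc m. of_nat (Suc m choose i) * f i)
       = (\<Sum>i\<le>m. of_nat (m choose i) * (f i + f (Suc i)))"
proof -
  have "(\<Sum>i\<le>Suc m. of_nat (Suc m choose i) * f i)
      = f 0 + (\<Sum>i\<le>m. of_nat (Suc m choose Suc i) * f (Suc i))"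
    by (simp only: sum.atMost_Suc_shift) simp
  also have "\<dots> = f 0 + (\<Sum>i\<le>m. of_nat (m choose Suc i) * f (Suc i))
                 + (\<Sum>i\<le>m. of_nat (m choose i) * f (Suc i))"
    by (simp add: distrib_right sum.distrib add.commute add.left_commute)
  also have "f 0 + (\<Sum>i\<le>m. of_nat (m choose Suc i) * f (Suc i))
      = (\<Sum>i\<le>Suc m. of_nat (m choose i) * f i)"
    by (simp only: sum.atMost_Suc_shift) simp
  also have "\<dots> = (\<Sum>i\<le>m. of_nat (m choose i) * f i)"
    by (simp add: binomial_eq_0)
  finally show ?thesis
    by (simp add: distrib_left sum.distrib)
qed

text \<open>In operator form, (1+E)^m (1+E)^n = (1+E)^(m+n). It collapses a double sum whose weight
  depends on i and j only through i+j.\<close>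

lemma sum_choose_convolution:
  fixes f :: "nat \<Rightarrow> 'a::comm_semiring_1"
  shows "(\<Sum>i\<le>m. \<Sum>j\<le>n. of_nat (m choose i) * of_nat (n choose j) * f (i + j))
       = (\<Sum>s\<le>m + n. of_nat ((m + n) choose s) * f s)"
proof -
  have "(\<Sum>i\<le>m. of_nat (m choose i) * (\<Sum>j\<le>n. of_nat (n choose j) * f (i + j)))
      = (\<Sum>s\<le>m + n. of_nat ((m + n) choose s) * f s)"
  proof (induction m arbitrary: f)
    case 0
    then show ?case by simp
  next
    case (Suc m)
    have "(\<Sum>i\<le>Suc m. of_nat (Suc m choose i) * (\<Sum>j\<le>n. of_nat (n choose j) * f (i + j)))
        = (\<Sum>i\<le>m. of_nat (m choose i) * (\<Sum>j\<le>n. of_nat (n choose j) * (f (i + j) + f (Suc (i + j)))))"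
      by (simp only: sum_choose_Suc) (simp add: distrib_left sum.distrib)
    also have "\<dots> = (\<Sum>s\<le>Suc m + n. of_nat ((Suc m + n) choose s) * f s)"
      by (simp only: Suc.IH[of "\<lambda>s. f s + f (Suc s)"] add_Suc sum_choose_Suc)
    finally show ?case .
  qed
  then show ?thesis
    by (simp add: sum_distrib_left mult.assoc)
qed

text \<open>Vandermonde's convolution. The offset \<open>c\<close> stays general because the shift
  changes it during the induction; the case needed later is c = k.\<close>

lemma choose_add_as_sum:
  "(\<Sum>i\<le>k. (k choose i) * (n choose (c + i))) = (n + k) choose (c + k)"
proof (induction k arbitrary: c)
  case 0
  then show ?case by simp
next
  case (Suc k)
  show ?case
    using Suc.IH[of c] Suc.IH[of "Suc c"] sum_choose_Suc[of k "\<lambda>i. n choose (c + i)"]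
    by (simp add: distrib_left sum.distrib)
qed

text \<open>At c = k this is the image of \<open>choose_add_as_sum\<close> under n -> -1-n, which
  takes C(n,a) to (-1)^a C(n+a,a) and fixes C(n+k,2k).\<close>

lemma choose_add_as_alternating_sum:
  "(\<Sum>i\<le>k. of_nat (k choose i) * ((-1) ^ (k + i) * of_nat ((n + c + i) choose (c + i))))
     = (of_nat ((n + c) choose (c + k)) :: 'a::comm_ring_1)"
proof (induction k arbitrary: c)
  case 0
  then show ?case by simp
next
  case (Suc k)
  have "(\<Sum>i\<le>Suc k. of_nat (Suc k choose i) * ((-1) ^ (Suc k + i) * of_nat ((n + c + i) choose (c + i))))
      = (of_nat ((n + Suc c) choose (Suc c + k)) - of_nat ((n + c) choose (c + k)) :: 'a)"
    by (simp only: sum_choose_Suc Suc.IH[symmetric]) (simp add: algebra_simps sum.distrib sum_negf)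
  then show ?case by simp
qed

text \<open>The beta integral \<open>\<integral> t ^ n * (1 - t) ^ m\<close> over \<open>[0, 1]\<close>, expanded binomially.\<close>

lemma beta_sum:
  "(\<Sum>i\<le>m. of_nat (m choose i) * ((-1) ^ i / of_nat (n + i + 1)))
     = (fact m * fact n / fact (n + m + 1) :: 'a::field_char_0)"
proof (induction m arbitrary: n)
  case 0
  have "of_nat (n + 1) \<noteq> (0::'a)" "fact n \<noteq> (0::'a)" by (simp_all del: of_nat_Suc)
  then show ?case by (simp add: divide_simps del: of_nat_Suc)
next
  case (Suc m)
  have nz: "of_nat (n + m + 2) \<noteq> (0::'a)" "fact (n + m + 1) \<noteq> (0::'a)"
    by (simp_all only: of_nat_eq_0_iff fact_nonzero) simp
  \<comment> \<open>On the integrals this is (1-t)^(m+1) = (1-t)^m - t (1-t)^m.\<close>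
  have "(\<Sum>i\<le>Suc m. of_nat (Suc m choose i) * ((-1) ^ i / of_nat (n + i + 1)))
      = (\<Sum>i\<le>m. of_nat (m choose i) * ((-1) ^ i / of_nat (n + i + 1)))
        - (\<Sum>i\<le>m. of_nat (m choose i) * ((-1) ^ i / (of_nat (Suc n + i + 1) :: 'a)))"
    by (simp only: sum_choose_Suc) (simp add: distrib_left sum.distrib sum_negf right_diff_distrib sum_subtractf)
  also have "\<dots> = fact m * fact n / fact (n + m + 1) - fact m * fact (Suc n) / fact (Suc n + m + 1)"
    by (simp only: Suc.IH)
  also have "\<dots> = (fact m * fact n * of_nat (n + m + 2) - fact m * fact (Suc n)) / (of_nat (n + m + 2) * fact (n + m + 1))"
    using nz by (simp add: diff_divide_distrib del: of_nat_add of_nat_Suc fact_Suc)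
       (simp add: ac_simps)
  also have "\<dots> = fact (Suc m) * fact n / fact (n + Suc m + 1)"
    by (simp add: algebra_simps)
  finally show ?case .
qed

section \<open>The power sums of the binomials\<close>

text \<open>Telescoping in \<open>p\<close>: by Pascal's rule the right side grows by C(a+b,a)
  C(p+b,a+b). For a \<le> p this and the new summand both equal (p+b)!/(a! b! (p-a)!), and for a > p
  both vanish.\<close>

lemma sum_choose_mult_choose:
  "(\<Sum>n<p. (n choose a) * ((n + b) choose b)) = ((a + b) choose a) * ((p + b) choose (a + b + 1))"
proof (induction p)
  case 0
  then show ?case by simp
next
  case (Suc p)
  have "(p choose a) * ((p + b) choose b) = ((a + b) choose a) * ((p + b) choose (a + b))"
  proof (cases "a \<le> p")
    case True
    then have "((p + b) choose (a + b)) * ((a + b) choose b) = ((p + b) choose b) * ((p + b - b) choose (a + b - b))"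
      by (intro choose_mult) auto
    moreover have "(a + b) choose b = (a + b) choose a"
      using binomial_symmetric[of a "a + b"] by simp
    ultimately show ?thesis by (simp add: mult.commute)
  qed (simp add: binomial_eq_0)
  with Suc show ?case by (simp add: algebra_simps)
qed

text \<open>Up to the factor a+b+1, the left side is the product of the consecutive integers from
  p-a to p+b, divided by a! b!. The middle one is p; the others are p-i = -i(1-p/i) and p+i =
  i(1+p/i).\<close>

lemma choose_mult_choose_eq_prod:
  "of_nat ((a + b) choose a) * of_nat ((p + b) choose (a + b + 1))
   = of_nat p / of_nat (a + b + 1) *
     ((-1) ^ a * (\<Prod>i=1..a. 1 + - of_nat p / of_nat i) * (\<Prod>i=1..b. 1 + of_nat p / of_nat i) :: 'a::field_char_0)"
proof -
  \<comment> \<open>Clearing the denominator a+b+1 makes each unit step in \<open>a\<close>, and in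
    \<open>b\<close> when a = 0, a multiplication by one linear factor. The point (a,b) is reached
    from (0,0) through (0,b).\<close>
  define G where "G a b = (of_nat ((a + b) choose a) * of_nat ((p + b) choose (a + b + 1)) * of_nat (a + b + 1) :: 'a)" for a b
  have step_b: "G 0 (Suc b) = G 0 b * (1 + of_nat p / of_nat (Suc b))" for b
  proof -
    have "Suc (Suc b) * ((p + Suc b) choose Suc (Suc b)) = (p + Suc b) * ((p + b) choose Suc b)"
      using Suc_times_binomial[of "Suc b" "p + b"] by simp
    then have "of_nat (Suc (Suc b)) * of_nat ((p + Suc b) choose Suc (Suc b)) = (of_nat (p + Suc b) * of_nat ((p + b) choose Suc b) :: 'a)"
      by (metis of_nat_mult)
    then have "G 0 (Suc b) = of_nat (p + Suc b) * of_nat ((p + b) choose Suc b)"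
      by (simp add: G_def mult.commute)
    moreover have "of_nat (p + Suc b) = of_nat (Suc b) * (1 + of_nat p / of_nat (Suc b) :: 'a)"
      by (simp add: distrib_left del: of_nat_Suc) simp
    ultimately show ?thesis by (simp add: G_def ac_simps)
  qed
  have step_a: "G (Suc a) b = G a b * - (1 + - of_nat p / of_nat (Suc a))" for a b
  proof -
    have 1: "Suc a * ((Suc a + b) choose Suc a) = (a + b + 1) * ((a + b) choose a)"
      using Suc_times_binomial[of a "a + b"] by simp
    have 2: "of_nat (a + b + 2) * of_nat ((p + b) choose (a + b + 2))
           = (of_nat p - of_nat (Suc a)) * (of_nat ((p + b) choose (a + b + 1)) :: 'a)"
    proof (cases "a + 1 \<le> p")
      case True
      have "(a + b + 2) * ((p + b) choose (a + b + 2)) = (p - Suc a) * ((p + b) choose (a + b + 1))"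
        using binomial_absorb_comp[of "p + b" "a + b + 1"] binomial_absorption[of "a + b + 1" "p + b"]
        by simp
      then have "of_nat (a + b + 2) * of_nat ((p + b) choose (a + b + 2))
           = of_nat (p - Suc a) * (of_nat ((p + b) choose (a + b + 1)) :: 'a)"
        by (metis of_nat_mult)
      then show ?thesis using True by (simp add: of_nat_diff)
    next
      case False
      then show ?thesis by (simp add: binomial_eq_0)
    qed
    have 1: "of_nat (Suc a) * of_nat ((Suc a + b) choose Suc a) = (of_nat (a + b + 1) * of_nat ((a + b) choose a) :: 'a)"
      using 1 by (metis of_nat_mult)
    have "of_nat (Suc a) * G (Suc a) b = G a b * (of_nat p - of_nat (Suc a))"
    proof -
      have e: "Suc a + b + 1 = a + b + 2" by simp
      have "of_nat (Suc a) * G (Suc a) b = (of_nat (Suc a) * of_nat ((Suc a + b) choose Suc a))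
              * (of_nat (a + b + 2) * of_nat ((p + b) choose (a + b + 2)))"
        unfolding G_def e by (simp only: ac_simps)
      also have "\<dots> = G a b * (of_nat p - of_nat (Suc a))"
        unfolding 1 2 G_def by (simp only: ac_simps)
      finally show ?thesis .
    qed
    moreover have "of_nat p - of_nat (Suc a) = (of_nat (Suc a) :: 'a) * - (1 + - of_nat p / of_nat (Suc a))"
      by (simp add: field_simps del: of_nat_Suc)
    ultimately have "of_nat (Suc a) * G (Suc a) b = of_nat (Suc a) * (G a b * - (1 + - of_nat p / of_nat (Suc a)))"
      by (simp only: ac_simps)
    then show ?thesis
      using of_nat_neq_0[where ?'a = 'a] mult_cancel_left by blast
  qed
  have "G 0 b = of_nat p * (\<Prod>i=1..b. 1 + of_nat p / of_nat i)" for b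
  proof (induction b)
    case 0
    then show ?case by (simp add: G_def)
  next
    case (Suc b)
    then show ?case by (simp add: step_b)
  qed
  moreover have "G a b = G 0 b * ((-1) ^ a * (\<Prod>i=1..a. 1 + - of_nat p / of_nat i))"
  proof (induction a)
    case 0
    then show ?case by simp
  next
    case (Suc a)
    then show ?case by (simp add: step_a algebra_simps)
  qed
  ultimately have "G a b = of_nat p * ((-1) ^ a * (\<Prod>i=1..a. 1 + - of_nat p / of_nat i) * (\<Prod>i=1..b. 1 + of_nat p / of_nat i))"
    by (simp add: ac_simps)
  moreover have "of_nat (a + b + 1) \<noteq> (0::'a)"
    by (simp only: of_nat_eq_0_iff)
  ultimately show ?thesis
    unfolding G_def by (simp add: eq_divide_eq del: of_nat_add)
qed

lemma sum_choose_square: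
  "(\<Sum>n<p. of_nat ((n + k) choose (2 * k)) ^ 2)
   = (\<Sum>i\<le>k. \<Sum>j\<le>k. of_nat (k choose i) * of_nat (k choose j)
        * ((-1) ^ (i + j) * (of_nat p / of_nat (2 * k + (i + j) + 1)))
        * ((\<Prod>l=1..k + i. 1 + - of_nat p / of_nat l)
           * (\<Prod>l=1..k + j. 1 + of_nat p / of_nat l) :: 'a::field_char_0))"
proof -
  let ?C = "\<lambda>n m. of_nat (n choose m) :: 'a"
  have 1: "?C (n + k) (2 * k) = (\<Sum>i\<le>k. ?C k i * ?C n (k + i))" for n
    using choose_add_as_sum[of k n k] by (simp flip: mult_2 of_nat_mult of_nat_sum)
  have 2: "?C (n + k) (2 * k) = (\<Sum>j\<le>k. ?C k j * ((-1) ^ (k + j) * ?C (n + (k + j)) (k + j)))" for n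
    using choose_add_as_alternating_sum[where ?'a = 'a, of k n k] by (simp flip: mult_2 add.assoc)
  have 3: "(\<Sum>n<p. ?C n a * ?C (n + b) b) = ?C (a + b) a * ?C (p + b) (a + b + 1)" for a b
    using arg_cong[OF sum_choose_mult_choose[of a b p], of "of_nat :: nat \<Rightarrow> 'a"]
    by (simp only: of_nat_sum of_nat_mult)
  have "(\<Sum>n<p. ?C (n + k) (2 * k) ^ 2)
      = (\<Sum>n<p. (\<Sum>i\<le>k. ?C k i * ?C n (k + i)) * (\<Sum>j\<le>k. ?C k j * ((-1) ^ (k + j) * ?C (n + (k + j)) (k + j))))"
    by (simp only: power2_eq_square 1[symmetric] 2[symmetric])
  also have "\<dots> = (\<Sum>n<p. \<Sum>i\<le>k. \<Sum>j\<le>k. ?C k i * ?C k j * (-1) ^ (k + j) * (?C n (k + i) * ?C (n + (k + j)) (k + j)))"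
    by (simp only: sum_product ac_simps)
  also have "\<dots> = (\<Sum>i\<le>k. \<Sum>j\<le>k. \<Sum>n<p. ?C k i * ?C k j * (-1) ^ (k + j) * (?C n (k + i) * ?C (n + (k + j)) (k + j)))"
    by (subst sum.swap) (intro sum.cong refl sum.swap)
  also have "\<dots> = (\<Sum>i\<le>k. \<Sum>j\<le>k. ?C k i * ?C k j * (-1) ^ (k + j)
        * (?C (k + i + (k + j)) (k + i) * ?C (p + (k + j)) (k + i + (k + j) + 1)))"
    by (simp only: sum_distrib_left[symmetric] 3)
  also have "\<dots> = (\<Sum>i\<le>k. \<Sum>j\<le>k. ?C k i * ?C k j
        * ((-1) ^ (i + j) * (of_nat p / of_nat (2 * k + (i + j) + 1)))
        * ((\<Prod>l=1..k + i. 1 + - of_nat p / of_nat l) * (\<Prod>l=1..k + j. 1 + of_nat p / of_nat l)))"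
  proof (intro sum.cong refl)
    fix i j
    have e: "k + i + (k + j) + 1 = 2 * k + (i + j) + 1" by simp
    \<comment> \<open>One sign comes from the reflected expansion, the other from the product
      formula with a = k+i.\<close>
    have "(-1) ^ (k + j) * (-1) ^ (k + i) = ((-1) ^ (2 * k + (i + j)) :: 'a)"
      by (simp add: power_add[symmetric] ac_simps flip: mult_2)
    also have "\<dots> = (-1) ^ (i + j)" by (simp add: power_add)
    finally have sgn: "(-1) ^ (i + j) = ((-1) ^ (k + j) * (-1) ^ (k + i) :: 'a)" by (rule sym)
    show "?C k i * ?C k j * (-1) ^ (k + j)
        * (?C (k + i + (k + j)) (k + i) * ?C (p + (k + j)) (k + i + (k + j) + 1))
      = ?C k i * ?C k j * ((-1) ^ (i + j) * (of_nat p / of_nat (2 * k + (i + j) + 1)))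
        * ((\<Prod>l=1..k + i. 1 + - of_nat p / of_nat l) * (\<Prod>l=1..k + j. 1 + of_nat p / of_nat l))"
      unfolding choose_mult_choose_eq_prod unfolding e sgn by (simp only: ac_simps)
  qed
  finally show ?thesis .
qed

text \<open>The weight depends only on s = i+j, so convolution leaves a single sum over C(2k,s),
  which is the beta integral with both exponents 2k.\<close>

lemma beta_double_sum:
  "(\<Sum>i\<le>k. \<Sum>j\<le>k. of_nat (k choose i) * of_nat (k choose j)
      * ((-1) ^ (i + j) * (c / of_nat (2 * k + (i + j) + 1))))
   = (c * fact (2 * k) ^ 2 / fact (4 * k + 1) :: 'a::field_char_0)"
proof -
  have "(\<Sum>i\<le>k. \<Sum>j\<le>k. of_nat (k choose i) * of_nat (k choose j)
      * ((-1) ^ (i + j) * (c / of_nat (2 * k + (i + j) + 1))))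
    = (\<Sum>s\<le>2 * k. of_nat (2 * k choose s) * ((-1) ^ s * (c / of_nat (2 * k + s + 1))))"
    using sum_choose_convolution[of k k "\<lambda>s. (-1) ^ s * (c / of_nat (2 * k + s + 1))"]
    by (simp only: mult_2)
  also have "\<dots> = c * (\<Sum>s\<le>2 * k. of_nat (2 * k choose s) * ((-1) ^ s / of_nat (2 * k + s + 1)))"
    by (simp add: sum_distrib_left ac_simps del: of_nat_add of_nat_Suc)
  also have "\<dots> = c * (fact (2 * k) * fact (2 * k) / fact (2 * k + 2 * k + 1))"
    by (simp only: beta_sum)
  finally show ?thesis by (simp add: power2_eq_square flip: mult_2)
qed

lemma sum_A_eq:
  "(\<Sum>n<p. A n x) = (\<Sum>k<p. int ((2 * k) choose k) ^ 2 * x ^ k * (\<Sum>n<p. int ((n + k) choose (2 * k)) ^ 2))"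
proof -
  have "A n x = (\<Sum>k<p. int ((2 * k) choose k) ^ 2 * x ^ k * int ((n + k) choose (2 * k)) ^ 2)" if "n < p" for n
  proof -
    have *: "(n choose k) * ((n + k) choose k) = ((n + k) choose (2 * k)) * ((2 * k) choose k)" if "k \<le> n" for k
      using choose_mult[of k "2 * k" "n + k"] that by (simp add: mult_2 mult.commute)
    have "A n x = (\<Sum>k=0..n. int ((2 * k) choose k) ^ 2 * x ^ k * int ((n + k) choose (2 * k)) ^ 2)"
      unfolding A_def
    proof (intro sum.cong refl)
      fix k assume "k \<in> {0..n}"
      then have "int (n choose k) * int ((n + k) choose k) = int ((n + k) choose (2 * k)) * int ((2 * k) choose k)"
        using *[of k] by (simp flip: of_nat_mult)
      then have "int (n choose k) ^ 2 * int ((n + k) choose k) ^ 2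
          = int ((n + k) choose (2 * k)) ^ 2 * int ((2 * k) choose k) ^ 2"
        by (simp only: power_mult_distrib[symmetric])
      then show "int (n choose k) ^ 2 * int ((n + k) choose k) ^ 2 * x ^ k
          = int ((2 * k) choose k) ^ 2 * x ^ k * int ((n + k) choose (2 * k)) ^ 2"
        by (simp only: ac_simps)
    qed
    \<comment> \<open>Terms with n < k vanish because n+k < 2k; a range independent of n permits
      exchanging the two sums.\<close>
    also have "\<dots> = (\<Sum>k<p. int ((2 * k) choose k) ^ 2 * x ^ k * int ((n + k) choose (2 * k)) ^ 2)"
      using that by (intro sum.mono_neutral_left) (auto simp: binomial_eq_0)
    finally show ?thesis .
  qed
  then have "(\<Sum>n<p. A n x) = (\<Sum>n<p. \<Sum>k<p. int ((2 * k) choose k) ^ 2 * x ^ k * int ((n + k) choose (2 * k)) ^ 2)"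
    by (intro sum.cong) auto
  also have "\<dots> = (\<Sum>k<p. int ((2 * k) choose k) ^ 2 * x ^ k * (\<Sum>n<p. int ((n + k) choose (2 * k)) ^ 2))"
    by (subst sum.swap) (simp add: sum_distrib_left)
  finally show ?thesis .
qed

section \<open>Arithmetic modulo powers of a prime\<close>

context
  fixes p :: nat
  assumes p: "prime p"
begin

text \<open>The reduced denominator divides the denominator of every other representation. Hence any
  fraction with denominator prime to p may serve as a witness, and the closure proofs never reduce
  fractions.\<close>

lemma p_integral_iff:
  "q \<in> p_integral p \<longleftrightarrow> (\<exists>a b. coprime b (int p) \<and> q = of_int a / of_int b)"
proof
  assume "q \<in> p_integral p"
  then show "\<exists>a b. coprime b (int p) \<and> q = of_int a / of_int b"
    unfolding p_integral_def by (metis mem_Collect_eq prod.collapse quotient_of_div)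
next
  assume "\<exists>a b. coprime b (int p) \<and> q = of_int a / of_int b"
  then obtain a b where ab: "coprime b (int p)" "q = of_int a / of_int b" by blast
  obtain c d where cd: "quotient_of q = (c, d)" by (cases "quotient_of q")
  have d: "d > 0" "coprime c d" "q = of_int c / of_int d"
    using cd quotient_of_denom_pos quotient_of_coprime quotient_of_div by blast+
  have "b \<noteq> 0" using ab(1) p by (auto simp: prime_nat_iff)
  then have "of_int (a * d) = (of_int (c * b) :: rat)"
    using ab(2) d by (simp add: field_simps)
  then have "a * d = c * b" by (simp only: of_int_eq_iff)
  then have "d dvd c * b" by (metis dvd_triv_right)
  then have "d dvd b" using d(2) by (simp add: coprime_commute coprime_dvd_mult_right_iff)
  then have "coprime d (int p)" using ab(1) by (meson coprime_divisors dvd_refl)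
  then show "q \<in> p_integral p" by (simp add: p_integral_def cd)
qed

lemma p_integral_of_int [simp]: "of_int a \<in> p_integral p"
  unfolding p_integral_iff by (rule exI[of _ a], rule exI[of _ 1]) simp

lemma p_integral_of_nat [simp]: "of_nat n \<in> p_integral p"
  using p_integral_of_int[of "int n"] by simp

lemma p_integral_0 [simp]: "0 \<in> p_integral p"
  and p_integral_1 [simp]: "1 \<in> p_integral p"
  and p_integral_numeral [simp]: "numeral w \<in> p_integral p"
  using p_integral_of_nat[of 0] p_integral_of_nat[of 1] p_integral_of_nat[of "numeral w"] by simp_all

lemma p_integral_inverse:
  assumes "\<not> p dvd n"
  shows "1 / of_nat n \<in> p_integral p"
proof -
  have "coprime (int n) (int p)"
    using assms p by (metis coprime_commute coprime_int_iff prime_imp_coprime)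
  then show ?thesis
    unfolding p_integral_iff by (intro exI[of _ 1] exI[of _ "int n"]) simp
qed

lemma p_integral_add [intro, simp]:
  assumes "a \<in> p_integral p" "b \<in> p_integral p"
  shows "a + b \<in> p_integral p"
proof -
  from assms obtain u v w z where
    *: "coprime v (int p)" "a = of_int u / of_int v" "coprime z (int p)" "b = of_int w / of_int z"
    unfolding p_integral_iff by blast
  have "v \<noteq> 0" "z \<noteq> 0" using * p by (auto simp: prime_nat_iff)
  then have "a + b = of_int (u * z + w * v) / of_int (v * z)" using * by (simp add: field_simps)
  moreover have "coprime (v * z) (int p)" using * by simp
  ultimately show ?thesis unfolding p_integral_iff by blast
qed

lemma p_integral_mult [intro, simp]:
  assumes "a \<in> p_integral p" "b \<in> p_integral p"
  shows "a * b \<in> p_integral p"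
proof -
  from assms obtain u v w z where
    *: "coprime v (int p)" "a = of_int u / of_int v" "coprime z (int p)" "b = of_int w / of_int z"
    unfolding p_integral_iff by blast
  then have "a * b = of_int (u * w) / of_int (v * z)" by simp
  moreover have "coprime (v * z) (int p)" using * by simp
  ultimately show ?thesis unfolding p_integral_iff by blast
qed

lemma p_integral_uminus [intro, simp]: "a \<in> p_integral p \<Longrightarrow> - a \<in> p_integral p"
  using p_integral_mult[of "- 1" a] p_integral_of_int[of "-1"] by simp

lemma p_integral_diff [intro, simp]:
  "a \<in> p_integral p \<Longrightarrow> b \<in> p_integral p \<Longrightarrow> a - b \<in> p_integral p"
  using p_integral_add[of a "- b"] by simp

lemma p_integral_power [intro, simp]: "a \<in> p_integral p \<Longrightarrow> a ^ n \<in> p_integral p"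
  by (induction n) auto

lemma p_integral_sum [intro]: "(\<And>i. i \<in> I \<Longrightarrow> f i \<in> p_integral p) \<Longrightarrow> sum f I \<in> p_integral p"
  by (induction I rule: infinite_finite_induct) auto

section \<open>Congruences between p-integral rationals, and powers of p in denominators\<close>

lemma p_cong_refl: "a \<in> p_integral p \<Longrightarrow> p_cong p m a a"
  unfolding p_cong_def by (auto intro!: bexI[of _ 0])

lemma p_cong_sym: "p_cong p m a b \<Longrightarrow> p_cong p m b a"
  unfolding p_cong_def by (auto, metis minus_diff_eq mult_minus_right p_integral_uminus)

lemma p_cong_trans: "p_cong p m a b \<Longrightarrow> p_cong p m b c \<Longrightarrow> p_cong p m a c"
  unfolding p_cong_def
  by (auto, metis (no_types, opaque_lifting) diff_add_cancel add_diff_eq distrib_left p_integral_add)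

lemma p_cong_add:
  assumes "p_cong p m a b" "p_cong p m c d"
  shows "p_cong p m (a + c) (b + d)"
proof -
  from assms obtain u v where uv: "u \<in> p_integral p" "a - b = m * u" "v \<in> p_integral p" "c - d = m * v"
    unfolding p_cong_def by blast
  then have "(a + c) - (b + d) = m * (u + v)" by (simp add: algebra_simps)
  with uv assms show ?thesis unfolding p_cong_def by blast
qed

lemma p_cong_mult:
  assumes "p_cong p m a b" "p_cong p m c d"
  shows "p_cong p m (a * c) (b * d)"
proof -
  from assms obtain u v where uv: "u \<in> p_integral p" "a - b = m * u" "v \<in> p_integral p" "c - d = m * v"
    unfolding p_cong_def by blast
  have "a * c - b * d = (a - b) * c + b * (c - d)" by (simp add: algebra_simps)
  also have "\<dots> = m * (u * c + b * v)" unfolding uv by (simp add: algebra_simps)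
  finally show ?thesis using uv assms unfolding p_cong_def by blast
qed

lemma p_cong_scale:
  "c \<in> p_integral p \<Longrightarrow> p_cong p m a b \<Longrightarrow> p_cong p m (c * a) (c * b)"
  by (intro p_cong_mult p_cong_refl)

lemma p_cong_sum:
  "(\<And>i. i \<in> I \<Longrightarrow> p_cong p m (f i) (g i)) \<Longrightarrow> p_cong p m (sum f I) (sum g I)"
  by (induction I rule: infinite_finite_induct) (auto intro: p_cong_add p_cong_refl)

lemma p_cong_0I: "m \<in> p_integral p \<Longrightarrow> c \<in> p_integral p \<Longrightarrow> a = m * c \<Longrightarrow> p_cong p m a 0"
  unfolding p_cong_def by auto

text \<open>For n < p^2 each multiple of p up to n contributes exactly one factor p to n!, so
  \<open>n div p\<close> factors suffice to clear the denominator.\<close>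

lemma power_div_fact_p_integral:
  assumes "n < p ^ 2" "n div p \<le> t"
  shows "of_nat p ^ t / fact n \<in> p_integral p"
proof -
  have "of_nat p ^ (n div p) / fact n \<in> p_integral p"
    using assms(1)
  proof (induction n)
    case 0
    then show ?case by simp
  next
    case (Suc n)
    have p0: "p > 0" using p by (simp add: prime_gt_0_nat)
    have IH: "of_nat p ^ (n div p) / fact n \<in> p_integral p" using Suc by simp
    show ?case
    proof (cases "p dvd Suc n")
      case True
      then obtain q where q: "Suc n = p * q" by blast
      have "p * q < p * p" using q Suc.prems by (simp add: power2_eq_square)
      then have "q < p" by simp
      moreover have "q > 0" using q by (cases q) auto
      ultimately have "\<not> p dvd q" by (simp add: nat_dvd_not_less)
      then have i: "1 / of_nat q \<in> p_integral p" by (rule p_integral_inverse)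
      have div: "Suc n div p = Suc (n div p)" using True by (simp add: div_Suc dvd_eq_mod_eq_0)
      have "of_nat p ^ (Suc n div p) / fact (Suc n)
          = (of_nat p * of_nat p ^ (n div p)) / (of_nat (p * q) * fact n :: rat)"
        unfolding div fact_Suc using q by simp
      also have "\<dots> = 1 / of_nat q * (of_nat p ^ (n div p) / fact n)"
        using p0 by simp
      finally show ?thesis using i IH by (simp only: p_integral_mult)
    next
      case False
      then have i: "1 / of_nat (Suc n) \<in> p_integral p" by (rule p_integral_inverse)
      have "of_nat p ^ (Suc n div p) / fact (Suc n)
          = 1 / of_nat (Suc n) * (of_nat p ^ (n div p) / fact n :: rat)"
        using False by (simp add: div_Suc dvd_eq_mod_eq_0)
      then show ?thesis using i IH by (simp only: p_integral_mult)
    qed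
  qed
  then have "of_nat p ^ (t - n div p) * (of_nat p ^ (n div p) / fact n) \<in> p_integral p"
    by (intro p_integral_mult p_integral_power p_integral_of_nat)
  then show ?thesis
    using assms(2) by (simp flip: power_add)
qed

text \<open>Below p^2 a positive integer contains p at most once. This bounds the weights
  p/(2k+i+j+1), where the denominator may be p itself.\<close>

lemma prime_div_p_integral:
  assumes "0 < n" "n < p ^ 2"
  shows "of_nat p / of_nat n \<in> p_integral p"
proof (cases "p dvd n")
  case True
  then obtain q where q: "n = p * q" by blast
  have "p * q < p * p" using q assms by (simp add: power2_eq_square)
  then have "q < p" by simp
  moreover have "q > 0" using q assms by (cases q) auto
  ultimately have "1 / of_nat q \<in> p_integral p"
    by (intro p_integral_inverse) (simp add: nat_dvd_not_less)
  then show ?thesis using p by (simp add: q prime_gt_0_nat)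
next
  case False
  then have "of_nat p * (1 / of_nat n) \<in> p_integral p"
    by (intro p_integral_mult p_integral_of_nat p_integral_inverse)
  then show ?thesis by simp
qed

section \<open>Expansions modulo p^2\<close>

lemma reciprocal_sum_p_integral:
  assumes "n < p"
  shows "(\<Sum>i=1..n. 1 / of_nat i) \<in> p_integral p"
  using assms by (intro p_integral_sum p_integral_inverse) (auto simp: nat_dvd_not_less)

text \<open>First-order expansion: all reciprocals are p-integral since n < p, so terms of degree
  two in p drop out. The parameter \<open>e\<close> serves both signs, 1 and -1.\<close>

lemma prod_one_plus_cong:
  assumes "n < p" "e \<in> p_integral p"
  shows "p_cong p (of_nat p ^ 2) (\<Prod>i=1..n. 1 + e * of_nat p / of_nat i)
           (1 + e * of_nat p * (\<Sum>i=1..n. 1 / of_nat i))"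
  using assms(1)
proof (induction n)
  case 0
  then show ?case by (simp add: p_cong_refl)
next
  case (Suc n)
  let ?h = "\<Sum>i=1..n. 1 / of_nat i :: rat"
  have r: "1 / of_nat (Suc n) \<in> p_integral p"
    using Suc.prems by (intro p_integral_inverse) (simp add: nat_dvd_not_less)
  have h: "?h \<in> p_integral p" using Suc.prems by (intro reciprocal_sum_p_integral) simp
  have f: "1 + e * of_nat p * (1 / of_nat (Suc n)) \<in> p_integral p"
    using r assms(2) by (intro p_integral_add p_integral_mult) auto
  have "p_cong p (of_nat p ^ 2)
      ((1 + e * of_nat p * (1 / of_nat (Suc n))) * (\<Prod>i=1..n. 1 + e * of_nat p / of_nat i))
      ((1 + e * of_nat p * (1 / of_nat (Suc n))) * (1 + e * of_nat p * ?h))"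
    using Suc f by (intro p_cong_scale) auto
  moreover have "p_cong p (of_nat p ^ 2)
      ((1 + e * of_nat p * (1 / of_nat (Suc n))) * (1 + e * of_nat p * ?h))
      (1 + e * of_nat p * (?h + 1 / of_nat (Suc n)))"
    unfolding p_cong_def
  proof (intro conjI bexI)
    show "(1 + e * of_nat p * (1 / of_nat (Suc n))) * (1 + e * of_nat p * ?h)
          - (1 + e * of_nat p * (?h + 1 / of_nat (Suc n)))
        = of_nat p ^ 2 * (e * e * (1 / of_nat (Suc n)) * ?h)"
      by (simp only: power2_eq_square) (simp only: algebra_simps)
    qed (insert f h r assms(2), (intro p_integral_add p_integral_mult p_integral_1 p_integral_of_nat; assumption)+)
  ultimately show ?case
    by (auto intro: p_cong_trans simp: mult.commute simp del: of_nat_Suc)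
qed

text \<open>With H the harmonic numbers, the linear terms of the two products are p(H_b - H_a) and
  p(H_a - H_b), which cancel.\<close>

lemma prod_symmetrized_cong:
  assumes "a < p" "b < p"
  shows "p_cong p (of_nat p ^ 2)
      ((\<Prod>i=1..a. 1 + - of_nat p / of_nat i) * (\<Prod>i=1..b. 1 + of_nat p / of_nat i)
       + (\<Prod>i=1..b. 1 + - of_nat p / of_nat i) * (\<Prod>i=1..a. 1 + of_nat p / of_nat i)) 2"
proof -
  let ?h = "\<lambda>n. \<Sum>i=1..n. 1 / of_nat i :: rat"
  have h: "?h a \<in> p_integral p" "?h b \<in> p_integral p"
    using reciprocal_sum_p_integral assms by blast+
  have m: "p_cong p (of_nat p ^ 2) (\<Prod>i=1..n. 1 + - of_nat p / of_nat i) (1 - of_nat p * ?h n)"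
    and q: "p_cong p (of_nat p ^ 2) (\<Prod>i=1..n. 1 + of_nat p / of_nat i) (1 + of_nat p * ?h n)"
    if "n < p" for n
    using prod_one_plus_cong[OF that, of "- 1"] prod_one_plus_cong[OF that, of 1] by simp_all
  have "p_cong p (of_nat p ^ 2)
      ((\<Prod>i=1..a. 1 + - of_nat p / of_nat i) * (\<Prod>i=1..b. 1 + of_nat p / of_nat i)
       + (\<Prod>i=1..b. 1 + - of_nat p / of_nat i) * (\<Prod>i=1..a. 1 + of_nat p / of_nat i))
      ((1 - of_nat p * ?h a) * (1 + of_nat p * ?h b) + (1 - of_nat p * ?h b) * (1 + of_nat p * ?h a))"
    using assms by (intro p_cong_add p_cong_mult m q)
  moreover have "p_cong p (of_nat p ^ 2)
      ((1 - of_nat p * ?h a) * (1 + of_nat p * ?h b) + (1 - of_nat p * ?h b) * (1 + of_nat p * ?h a)) 2"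
    unfolding p_cong_def
  proof (intro conjI bexI)
    show "(1 - of_nat p * ?h a) * (1 + of_nat p * ?h b) + (1 - of_nat p * ?h b) * (1 + of_nat p * ?h a) - 2
        = of_nat p ^ 2 * (- 2 * ?h a * ?h b)"
      by (simp only: power2_eq_square) (simp add: algebra_simps)
  qed (use h in \<open>auto intro!: p_integral_add p_integral_mult p_integral_diff\<close>)
  ultimately show ?thesis by (rule p_cong_trans)
qed

lemma sum_choose_square_cong:
  assumes "2 * k < p" "2 < p"
  shows "p_cong p (of_nat p ^ 2) (\<Sum>n<p. of_nat ((n + k) choose (2 * k)) ^ 2)
           (of_nat p * fact (2 * k) ^ 2 / fact (4 * k + 1))"
proof -
  define w :: "nat \<Rightarrow> nat \<Rightarrow> rat" where
    "w i j = of_nat (k choose i) * of_nat (k choose j)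
        * ((-1) ^ (i + j) * (of_nat p / of_nat (2 * k + (i + j) + 1)))" for i j
  define P Q :: "nat \<Rightarrow> rat" where
    "P i = (\<Prod>l=1..k + i. 1 + of_nat p / of_nat l)" and "Q i = (\<Prod>l=1..k + i. 1 + - of_nat p / of_nat l)" for i
  let ?S = "\<Sum>n<p. of_nat ((n + k) choose (2 * k)) ^ 2 :: rat"
  let ?B = "of_nat p * fact (2 * k) ^ 2 / fact (4 * k + 1) :: rat"
  have S: "?S = (\<Sum>i\<le>k. \<Sum>j\<le>k. w i j * (Q i * P j))"
    unfolding w_def P_def Q_def by (rule sum_choose_square)
  have w_sym: "w j i = w i j" for i j
    unfolding w_def by (simp only: ac_simps)
  \<comment> \<open>Interchanging i and j leaves the weight fixed, so averaging both forms of the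
    sum gives the symmetrized products.\<close>
  have "?S = (\<Sum>i\<le>k. \<Sum>j\<le>k. w i j * (Q j * P i))"
    unfolding S by (subst sum.swap) (simp only: w_sym)
  with S have "2 * ?S = (\<Sum>i\<le>k. \<Sum>j\<le>k. w i j * (Q i * P j)) + (\<Sum>i\<le>k. \<Sum>j\<le>k. w i j * (Q j * P i))"
    by (simp only: mult_2)
  also have "\<dots> = (\<Sum>i\<le>k. \<Sum>j\<le>k. w i j * (Q i * P j + Q j * P i))"
    by (simp add: distrib_left sum.distrib)
  finally have S2: "2 * ?S = (\<Sum>i\<le>k. \<Sum>j\<le>k. w i j * (Q i * P j + Q j * P i))" .
  \<comment> \<open>A weight need not be divisible by p, as 2k+i+j+1 can equal p; p-integrality is
    enough since the symmetrized products are known modulo p^2.\<close>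
  have w_int: "w i j \<in> p_integral p" if "i \<le> k" "j \<le> k" for i j
  proof -
    have "2 * k + (i + j) + 1 < 2 * p" using that assms by simp
    also have "2 * p \<le> p ^ 2" using assms by (simp add: power2_eq_square)
    finally have "of_nat p / of_nat (2 * k + (i + j) + 1) \<in> p_integral p"
      by (intro prime_div_p_integral) auto
    then show ?thesis
      unfolding w_def by (intro p_integral_mult p_integral_power p_integral_uminus p_integral_1 p_integral_of_nat)
  qed
  have "p_cong p (of_nat p ^ 2) (2 * ?S) (\<Sum>i\<le>k. \<Sum>j\<le>k. w i j * 2)"
    unfolding S2
  proof (intro p_cong_sum p_cong_scale)
    fix i j assume "i \<in> {..k}" "j \<in> {..k}"
    then show "w i j \<in> p_integral p" "p_cong p (of_nat p ^ 2) (Q i * P j + Q j * P i) 2"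
      using w_int prod_symmetrized_cong[of "k + i" "k + j"] assms(1) by (auto simp: P_def Q_def)
  qed
  moreover have "(\<Sum>i\<le>k. \<Sum>j\<le>k. w i j * 2) = 2 * ?B"
    using beta_double_sum[of k "of_nat p :: rat"]
    by (simp only: w_def sum_distrib_right[symmetric]) (rule mult.commute)
  ultimately have "p_cong p (of_nat p ^ 2) (2 * ?S) (2 * ?B)" by simp
  \<comment> \<open>As p is odd, 2 is a unit and the doubling can be undone.\<close>
  moreover have "1 / of_nat 2 \<in> p_integral p"
    using assms(2) by (intro p_integral_inverse) (simp add: nat_dvd_not_less)
  ultimately show ?thesis
    using p_cong_scale[of "1 / 2" "of_nat p ^ 2" "2 * ?S" "2 * ?B"] by simp
qed

text \<open>In the product formula with a = b = 2k both products have the same length, so the linear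
  terms cancel without symmetrizing: (1-pH)(1+pH) = 1 - p^2 H^2.\<close>

lemma choose_cong:
  assumes "2 * k < p"
  shows "p_cong p (of_nat p ^ 2) (of_nat ((p + 2 * k) choose (4 * k + 1)))
           (of_nat p * fact (2 * k) ^ 2 / fact (4 * k + 1))"
proof -
  let ?B = "of_nat p * fact (2 * k) ^ 2 / fact (4 * k + 1) :: rat"
  let ?h = "\<Sum>i=1..2 * k. 1 / of_nat i :: rat"
  let ?Q = "\<Prod>i=1..2 * k. 1 + - of_nat p / of_nat i :: rat" and ?P = "\<Prod>i=1..2 * k. 1 + of_nat p / of_nat i :: rat"
  have h: "?h \<in> p_integral p" using assms by (rule reciprocal_sum_p_integral)
  have "p_cong p (of_nat p ^ 2) (?Q * ?P) ((1 - of_nat p * ?h) * (1 + of_nat p * ?h))"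
    using prod_one_plus_cong[OF assms, of "- 1"] prod_one_plus_cong[OF assms, of 1]
    by (intro p_cong_mult) simp_all
  moreover have "p_cong p (of_nat p ^ 2) ((1 - of_nat p * ?h) * (1 + of_nat p * ?h)) 1"
    unfolding p_cong_def
  proof (intro conjI bexI)
    show "(1 - of_nat p * ?h) * (1 + of_nat p * ?h) - 1 = of_nat p ^ 2 * (- (?h * ?h))"
      by (simp only: power2_eq_square) (simp add: algebra_simps)
  qed (use h in \<open>auto intro!: p_integral_add p_integral_mult p_integral_diff\<close>)
  ultimately have PQ: "p_cong p (of_nat p ^ 2) (?Q * ?P) 1" by (rule p_cong_trans)
  \<comment> \<open>Since 4k+1 < 2p, the factorial (4k+1)! contains p at most once, and the factor p
    in the numerator compensates.\<close>
  have B: "?B \<in> p_integral p"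
  proof -
    have 1: "4 * k + 1 < 2 * p" using assms by simp
    have "2 * p \<le> p ^ 2" using prime_ge_2_nat[OF p] by (simp add: power2_eq_square)
    with 1 have "4 * k + 1 < p ^ 2" by linarith
    moreover have "(4 * k + 1) div p < 2"
      using 1 by (rule less_mult_imp_div_less)
    ultimately have "of_nat p ^ 1 / fact (4 * k + 1) \<in> p_integral p"
      by (intro power_div_fact_p_integral) linarith+
    then have "of_nat p ^ 1 / fact (4 * k + 1) * of_nat (fact (2 * k)) ^ 2 \<in> p_integral p"
      by (intro p_integral_mult p_integral_power p_integral_of_nat)
    then show ?thesis by simp
  qed
  \<comment> \<open>Dividing by C(4k,2k) turns the prefactor p/(4k+1) into
    \<open>?B\<close>.\<close>
  have "of_nat ((4 * k) choose (2 * k)) * of_nat ((p + 2 * k) choose (4 * k + 1))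
      = of_nat p / of_nat (4 * k + 1) * (?Q * ?P)"
    using choose_mult_choose_eq_prod[where ?'a = rat, of "2 * k" "2 * k" p] by simp
  moreover have "of_nat ((4 * k) choose (2 * k)) = (fact (4 * k) / fact (2 * k) ^ 2 :: rat)"
    using binomial_fact[where ?'a = rat, of "2 * k" "4 * k"] by (simp add: power2_eq_square)
  moreover have "fact (4 * k + 1) = (of_nat (4 * k + 1) * fact (4 * k) :: rat)"
    by (simp only: Suc_eq_plus1[symmetric] fact_Suc)
  moreover have "of_nat (4 * k + 1) \<noteq> (0 :: rat)"
    by (simp only: of_nat_eq_0_iff)
  ultimately have "of_nat ((p + 2 * k) choose (4 * k + 1)) = ?B * (?Q * ?P)"
    by (simp add: divide_simps del: of_nat_add of_nat_Suc fact_Suc) (simp only: ac_simps)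
  then show ?thesis using p_cong_scale[OF B PQ] by simp
qed

end

section \<open>Comparison of the three sums, coefficient by coefficient\<close>

theorem theorem1p3:
  fixes p :: nat and x :: int
  assumes "prime p" and "p > 3"
  shows "p_cong p (of_nat p ^ 2)
           (of_int (\<Sum>k=0..p - 1. A k x))
           (\<Sum>k=0..p - 1. fact (2 * k) ^ 4 * of_nat p / (fact (4 * k + 1) * fact k ^ 4) * of_int x ^ k)
       \<and> p_cong p (of_nat p ^ 2)
           (\<Sum>k=0..p - 1. fact (2 * k) ^ 4 * of_nat p / (fact (4 * k + 1) * fact k ^ 4) * of_int x ^ k)
           (of_int (\<Sum>k=0..(p - 1) div 2. int ((p + 2 * k) choose (4 * k + 1)) * int ((2 * k) choose k) ^ 2 * x ^ k))"
proof -
  note p = assms(1)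
  \<comment> \<open>Once all three sums run over k < p, their coefficients are
    \<open>W k * S k\<close>, \<open>W k * B k\<close> and \<open>W k * T k\<close>, with
    \<open>W k\<close> the square of C(2k,k).\<close>
  define B S T :: "nat \<Rightarrow> rat" where
    "B k = of_nat p * fact (2 * k) ^ 2 / fact (4 * k + 1)"
    and "S k = (\<Sum>n<p. of_nat ((n + k) choose (2 * k)) ^ 2)"
    and "T k = of_nat ((p + 2 * k) choose (4 * k + 1))" for k
  define W :: "nat \<Rightarrow> rat" where "W k = of_nat ((2 * k) choose k) ^ 2" for k
  have range: "{0..p - 1} = {..<p}" using assms by auto
  have A_sum: "of_int (\<Sum>k=0..p - 1. A k x) = (\<Sum>k<p. of_int x ^ k * (W k * S k))"
    unfolding range sum_A_eq W_def S_def by (simp add: ac_simps)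
  have M_sum: "(\<Sum>k=0..p - 1. fact (2 * k) ^ 4 * of_nat p / (fact (4 * k + 1) * fact k ^ 4) * of_int x ^ k)
      = (\<Sum>k<p. of_int x ^ k * (W k * B k))"
    unfolding range
  proof (intro sum.cong refl)
    fix k
    have "W k = fact (2 * k) ^ 2 / fact k ^ 4"
      using binomial_fact[where ?'a = rat, of k "2 * k"]
      by (simp add: W_def power_divide mult_2 power_mult_distrib flip: power_add)
    then show "fact (2 * k) ^ 4 * of_nat p / (fact (4 * k + 1) * fact k ^ 4) * of_int x ^ k
        = of_int x ^ k * (W k * B k)"
      by (simp add: B_def ac_simps flip: power_add)
  qed
  \<comment> \<open>Beyond (p-1)/2 one has 2k \<ge> p, hence 4k+1 > p+2k and the added binomials
    vanish.\<close>
  have "(\<Sum>k=0..(p - 1) div 2. int ((p + 2 * k) choose (4 * k + 1)) * int ((2 * k) choose k) ^ 2 * x ^ k)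
      = (\<Sum>k<p. int ((p + 2 * k) choose (4 * k + 1)) * int ((2 * k) choose k) ^ 2 * x ^ k)"
    using assms by (intro sum.mono_neutral_left) (auto intro!: binomial_eq_0)
  then have T_sum: "of_int (\<Sum>k=0..(p - 1) div 2. int ((p + 2 * k) choose (4 * k + 1)) * int ((2 * k) choose k) ^ 2 * x ^ k)
      = (\<Sum>k<p. of_int x ^ k * (W k * T k))"
    by (simp add: W_def T_def ac_simps)
  have W: "W k \<in> p_integral p" and S: "S k \<in> p_integral p" and T: "T k \<in> p_integral p" for k
    unfolding W_def S_def T_def
    by (intro p_integral_sum p_integral_power p_integral_of_nat p)+
  have x: "of_int x ^ k \<in> p_integral p" for k
    by (intro p_integral_power p_integral_of_int p)
  have main: "p_cong p (of_nat p ^ 2) (W k * S k) (W k * B k) \<and> p_cong p (of_nat p ^ 2) (W k * B k) (W k * T k)"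
    if k: "k < p" for k
  proof (cases "2 * k < p")
    case True
    then have "p_cong p (of_nat p ^ 2) (S k) (B k)"
      using assms unfolding S_def B_def by (intro sum_choose_square_cong) auto
    moreover have "p_cong p (of_nat p ^ 2) (B k) (T k)"
      unfolding B_def T_def by (rule p_cong_sym[OF p choose_cong[OF p True]])
    ultimately show ?thesis using W p by (blast intro: p_cong_scale)
  next
    \<comment> \<open>Here p^2 divides \<open>W k\<close>, so all three terms are congruent to 0
      once \<open>S k\<close>, \<open>B k\<close> and \<open>T k\<close> are p-integral. Only
      \<open>B k\<close> still needs an argument.\<close>
    case False
    then have "p dvd fact (2 * k)" using p by (simp add: prime_dvd_fact_iff)
    then obtain d where d: "fact (2 * k) = p * d" by blast
    \<comment> \<open>At most three factors p occur in (4k+1)!, matched by two from (2k)!^2 and one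
      from the explicit p. The count requires 4k+1 < p^2, which follows from p > 3.\<close>
    have 1: "4 * k + 1 < 4 * p" using k by simp
    moreover have "4 * p \<le> p ^ 2" using assms by (simp add: power2_eq_square)
    moreover have "(4 * k + 1) div p < 4"
      using 1 by (rule less_mult_imp_div_less)
    ultimately have "of_nat p ^ 3 / fact (4 * k + 1) \<in> p_integral p"
      by (intro power_div_fact_p_integral p) linarith+
    then have "of_nat d ^ 2 * (of_nat p ^ 3 / fact (4 * k + 1)) \<in> p_integral p"
      by (intro p_integral_mult p_integral_power p_integral_of_nat p)
    moreover have "fact (2 * k) = (of_nat p * of_nat d :: rat)"
      using arg_cong[OF d, of "of_nat :: nat \<Rightarrow> rat"] by simp
    ultimately have B: "B k \<in> p_integral p"
      by (simp add: B_def power2_eq_square power3_eq_cube ac_simps)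
    have "fact k * fact k * ((2 * k) choose k) = (fact (2 * k) :: nat)"
      using binomial_fact_lemma[of k "2 * k"] by (simp add: mult_2)
    with \<open>p dvd fact (2 * k)\<close> have "p dvd fact k * fact k * ((2 * k) choose k)" by metis
    \<comment> \<open>Since k < p, the prime does not divide k!.\<close>
    then have "p dvd (2 * k) choose k"
      using p k by (simp add: prime_dvd_mult_iff prime_dvd_fact_iff)
    then obtain c where c: "(2 * k) choose k = p * c" by blast
    have "p_cong p (of_nat p ^ 2) (W k * y) 0" if "y \<in> p_integral p" for y
      using p that by (intro p_cong_0I[of _ _ "of_nat c ^ 2 * y"] p_integral_mult p_integral_power p_integral_of_nat)
        (simp_all add: W_def c power_mult_distrib)
    then show ?thesis using S B T p by (blast intro: p_cong_trans p_cong_sym)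
  qed
  show ?thesis
    unfolding A_sum M_sum T_sum using main x p by (blast intro: p_cong_sum p_cong_scale)
qed

end
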